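(* Each of the following four dimensional real Lie algebras admits generalized complex structures of type $0$, of type $1$ and of type $2$: $\mathfrak{aff}(\mathbb R)\times\mathfrak{aff}(\mathbb R)$, $\mathfrak{aff}(\mathbb C)$, $\mathbb R\times\mathfrak e(2)$, $\mathbb R\times\mathfrak h_3$, $\mathbb R\times\mathfrak r_{3,0}$, $\mathfrak r_{4,-1,-1}$, $\mathfrak r'_{4,\mu,0}$ $(\mu>0)$, $\mathfrak d_{4,\frac12}$, $\mathfrak d_{4,2}$ and $\mathfrak d'_{4,\lambda}$ $(\lambda>0)$.
   Context: The Lie algebras have basis $e_0,e_1,e_2,e_3$ and the following nonzero brackets (up to skew-symmetry): $\mathfrak{aff}(\mathbb R)\times\mathfrak{aff}(\mathbb R)$: $[e_0,e_1]=e_1$, $[e_2,e_3]=e_3$. $\mathfrak{aff}(\mathbb C)$: $[e_0,e_2]=e_2$, $[e_0,e_3]=e_3$, $[e_1,e_2]=e_3$, $[e_1,e_3]=-e_2$. $\mathbb R\times\mathfrak e(2)$: $[e_1,e_2]=-e_3$, $[e_1,e_3]=e_2$. $\mathbb R\times\mathfrak h_3$: $[e_1,e_2]=e_3$. $\mathbb R\times\mathfrak r_{3,0}$: $[e_1,e_2]=e_2$. $\mathfrak r_{4,-1,-1}$: $[e_0,e_1]=e_1$, $[e_0,e_2]=-e_2$, $[e_0,e_3]=-e_3$. $\mathfrak r'_{4,\mu,0}$: $[e_0,e_1]=\mu e_1$, $[e_0,e_2]=-e_3$, $[e_0,e_3]=e_2$. $\mathfrak d_{4,\lambda}$: $[e_0,e_1]=\lambda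 e_1$, $[e_0,e_2]=(1-\lambda)e_2$, $[e_0,e_3]=e_3$, $[e_1,e_2]=e_3$. $\mathfrak d'_{4,\lambda}$: $[e_0,e_1]=\lambda e_1-e_2$, $[e_0,e_2]=e_1+\lambda e_2$, $[e_0,e_3]=2\lambda e_3$, $[e_1,e_2]=e_3$. A generalized complex structure on a real Lie algebra $\mathfrak g$ is an endomorphism $\mathcal J$ of $\mathfrak g\oplus\mathfrak g^*$ with $\mathcal J^2=-\mathrm{Id}$, orthogonal with respect to $\langle (x,\alpha),(y,\beta)\rangle=\frac12(\beta(x)+\alpha(y))$, and satisfying $[u,v]+\mathcal J[\mathcal Ju,v]+\mathcal J[u,\mathcal Jv]-[\mathcal Ju,\mathcal Jv]=0$ for all $u,v\in\mathfrak g\oplus\mathfrak g^*$, where $[(x,\alpha),(y,\beta)]=([x,y],-\beta\circ\mathrm{ad}(x)+\alpha\circ\mathrm{ad}(y))$. Write $\mathcal J=\begin{pmatrix}\mathcal J_1&\mathcal J_2\\ \mathcal J_3&\mathcal J_4\end{pmatrix}$ with respect to $\mathfrak g\oplus\mathfrak g^*$, so $\mathcal J_2:\mathfrak g^*\to\mathfrak g$. If $\dim\mathfrak g=2n$, $\mathcal J$ is of type $k$ when $\operatorname{rank}(\mathcal J_2)=2(n-k)$. *)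

theory Defs
  imports "HOL-Analysis.Analysis"
begin

section \<open>Real Lie algebras\<close>

text \<open>A finite dimensional real Lie algebra is a Euclidean space with a bracket \<open>br\<close>; the inner
  product of the space plays no role.\<close>

definition lie_algebra :: "('a::euclidean_space \<Rightarrow> 'a \<Rightarrow> 'a) \<Rightarrow> bool" where
  "lie_algebra br \<longleftrightarrow>
     bilinear br \<and> (\<forall>x. br x x = 0) \<and>
     (\<forall>x y z. br x (br y z) + br y (br z x) + br z (br x y) = 0)"

text \<open>The dual space is \<open>'a \<Rightarrow>\<^sub>L real\<close>: all linear functionals are bounded here. \<open>Blinfun\<close> is
  unspecified on maps that are not bounded linear; lemma \<open>ad_apply\<close> excludes this for Lie algebras.\<close>

definition ad :: "('a::euclidean_space \<Rightarrow> 'a \<Rightarrow> 'a) \<Rightarrow> 'a \<Rightarrow> ('a \<Rightarrow>\<^sub>L 'a)" where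
  "ad br x = Blinfun (br x)"

lemma ad_apply:
  assumes "lie_algebra br"
  shows "blinfun_apply (ad br x) = br x"
proof -
  have "linear (br x)"
    using assms by (simp add: lie_algebra_def bilinear_def)
  then show ?thesis
    unfolding ad_def by (intro bounded_linear_Blinfun_apply linear_conv_bounded_linear[THEN iffD1])
qed


section \<open>Generalized complex structures\<close>

definition pairing :: "'a::euclidean_space \<times> ('a \<Rightarrow>\<^sub>L real) \<Rightarrow> 'a \<times> ('a \<Rightarrow>\<^sub>L real) \<Rightarrow> real" where
  "pairing u v = (1/2) * (blinfun_apply (snd v) (fst u) + blinfun_apply (snd u) (fst v))"

definition courant_bracket ::
  "('a::euclidean_space \<Rightarrow> 'a \<Rightarrow> 'a) \<Rightarrow>
     'a \<times> ('a \<Rightarrow>\<^sub>L real) \<Rightarrow> 'a \<times> ('a \<Rightarrow>\<^sub>L real) \<Rightarrow> 'a \<times> ('a \<Rightarrow>\<^sub>L real)" where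
  "courant_bracket br u v =
     (br (fst u) (fst v), - (snd v o\<^sub>L ad br (fst u)) + (snd u o\<^sub>L ad br (fst v)))"

definition generalized_complex_structure ::
  "('a::euclidean_space \<Rightarrow> 'a \<Rightarrow> 'a) \<Rightarrow>
     ('a \<times> ('a \<Rightarrow>\<^sub>L real) \<Rightarrow> 'a \<times> ('a \<Rightarrow>\<^sub>L real)) \<Rightarrow> bool" where
  "generalized_complex_structure br J \<longleftrightarrow>
     lie_algebra br \<and>
     linear J \<and>
     (\<forall>u. J (J u) = - u) \<and>
     (\<forall>u v. pairing (J u) (J v) = pairing u v) \<and>
     (\<forall>u v. courant_bracket br u v + J (courant_bracket br (J u) v)
             + J (courant_bracket br u (J v)) - courant_bracket br (J u) (J v) = 0)"

definition J2_block ::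
  "('a::euclidean_space \<times> ('a \<Rightarrow>\<^sub>L real) \<Rightarrow> 'a \<times> ('a \<Rightarrow>\<^sub>L real)) \<Rightarrow> ('a \<Rightarrow>\<^sub>L real) \<Rightarrow> 'a" where
  "J2_block J \<alpha> = fst (J (0, \<alpha>))"

text \<open>The conjunct \<open>k \<le> n\<close> keeps the subtraction of natural numbers from truncating.\<close>

definition has_type ::
  "('a::euclidean_space \<times> ('a \<Rightarrow>\<^sub>L real) \<Rightarrow> 'a \<times> ('a \<Rightarrow>\<^sub>L real)) \<Rightarrow> nat \<Rightarrow> bool" where
  "has_type J k \<longleftrightarrow>
     (\<exists>n. DIM('a) = 2 * n \<and> k \<le> n \<and> dim (range (J2_block J)) = 2 * (n - k))"

definition admits_gcs_of_type :: "('a::euclidean_space \<Rightarrow> 'a \<Rightarrow> 'a) \<Rightarrow> nat \<Rightarrow> bool" where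
  "admits_gcs_of_type br k \<longleftrightarrow> (\<exists>J. generalized_complex_structure br J \<and> has_type J k)"


section \<open>The four dimensional Lie algebras\<close>

text \<open>The index type \<open>4\<close> of \<open>real ^ 4\<close> has the elements \<open>0, 1, 2, 3\<close>.\<close>

definition e :: "4 \<Rightarrow> real ^ 4" where
  "e i = axis i 1"

text \<open>A table entry \<open>(i, j, v)\<close> stands for the brackets \<open>[e i, e j] = v\<close> and \<open>[e j, e i] = - v\<close>;
  brackets of basis vectors that do not appear in the table vanish.\<close>

definition bracket_of :: "(4 \<times> 4 \<times> (real ^ 4)) list \<Rightarrow> real ^ 4 \<Rightarrow> real ^ 4 \<Rightarrow> real ^ 4" where
  "bracket_of T x y = (\<Sum>(i, j, v)\<leftarrow>T. (x $ i * y $ j - x $ j * y $ i) *\<^sub>R v)"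

definition aff_R_aff_R :: "real ^ 4 \<Rightarrow> real ^ 4 \<Rightarrow> real ^ 4" where
  "aff_R_aff_R = bracket_of [(0, 1, e 1), (2, 3, e 3)]"

definition aff_C :: "real ^ 4 \<Rightarrow> real ^ 4 \<Rightarrow> real ^ 4" where
  "aff_C = bracket_of [(0, 2, e 2), (0, 3, e 3), (1, 2, e 3), (1, 3, - e 2)]"

definition R_e2 :: "real ^ 4 \<Rightarrow> real ^ 4 \<Rightarrow> real ^ 4" where
  "R_e2 = bracket_of [(1, 2, - e 3), (1, 3, e 2)]"

definition R_h3 :: "real ^ 4 \<Rightarrow> real ^ 4 \<Rightarrow> real ^ 4" where
  "R_h3 = bracket_of [(1, 2, e 3)]"

definition R_r30 :: "real ^ 4 \<Rightarrow> real ^ 4 \<Rightarrow> real ^ 4" where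
  "R_r30 = bracket_of [(1, 2, e 2)]"

definition r4_m1_m1 :: "real ^ 4 \<Rightarrow> real ^ 4 \<Rightarrow> real ^ 4" where
  "r4_m1_m1 = bracket_of [(0, 1, e 1), (0, 2, - e 2), (0, 3, - e 3)]"

definition r4'_0 :: "real \<Rightarrow> real ^ 4 \<Rightarrow> real ^ 4 \<Rightarrow> real ^ 4" where
  "r4'_0 \<mu> = bracket_of [(0, 1, \<mu> *\<^sub>R e 1), (0, 2, - e 3), (0, 3, e 2)]"

definition d4 :: "real \<Rightarrow> real ^ 4 \<Rightarrow> real ^ 4 \<Rightarrow> real ^ 4" where
  "d4 lam = bracket_of [(0, 1, lam *\<^sub>R e 1), (0, 2, (1 - lam) *\<^sub>R e 2), (0, 3, e 3), (1, 2, e 3)]"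

definition d4' :: "real \<Rightarrow> real ^ 4 \<Rightarrow> real ^ 4 \<Rightarrow> real ^ 4" where
  "d4' lam = bracket_of
     [(0, 1, lam *\<^sub>R e 1 - e 2), (0, 2, e 1 + lam *\<^sub>R e 2), (0, 3, (2 * lam) *\<^sub>R e 3), (1, 2, e 3)]"

lemma all_index: "(\<forall>i::4. P i) \<longleftrightarrow> P 0 \<and> P 1 \<and> P 2 \<and> P 3"
proof -
  have "(4::4) = 0" by simp
  then show ?thesis by (metis exhaust_4)
qed

lemma bilinear_bracket_of: "bilinear (bracket_of T)"
  unfolding bilinear_def bracket_of_def
  by (induction T)
     (auto intro!: linearI simp: algebra_simps linear_iff)

lemma bracket_of_self: "bracket_of T x x = 0"
  unfolding bracket_of_def by (induction T) (auto simp: mult.commute)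

lemmas four_dim_defs = aff_R_aff_R_def aff_C_def R_e2_def R_h3_def R_r30_def r4_m1_m1_def
  r4'_0_def d4_def d4'_def

lemma lie_algebras_four_dim:
  "lie_algebra aff_R_aff_R" "lie_algebra aff_C" "lie_algebra R_e2" "lie_algebra R_h3"
  "lie_algebra R_r30" "lie_algebra r4_m1_m1" "lie_algebra (r4'_0 \<mu>)" "lie_algebra (d4 lam)"
  "lie_algebra (d4' lam)"
  unfolding lie_algebra_def four_dim_defs
  by (simp_all add: bilinear_bracket_of bracket_of_self)
     (simp_all add: bracket_of_def e_def axis_def vec_eq_iff all_index algebra_simps)

end

theory Submission
  imports Defs
begin

text \<open>Split the basis of the Lie algebra into two pairs and put on each of the two coordinate planes
  either a complex structure or a symplectic form. The sum of the two is an almost generalized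
  complex structure whose type is the number of complex planes. For every algebra of the list and
  every type some splitting gives an integrable structure; one can take \<open>I e\<^sub>i = \<plusminus>e\<^sub>j\<close> and
  \<open>\<omega> = e\<^sup>i \<and> e\<^sup>j\<close> on the planes, except that \<open>d4' \<lambda>\<close> needs \<open>2\<lambda> e\<^sup>0 \<and> e\<^sup>3 + e\<^sup>1 \<and> e\<^sup>2\<close>, the differential
  of \<open>e\<^sup>3\<close> up to sign, for type \<open>0\<close>.\<close>

section \<open>Transport from the dual space to coordinate pairs\<close>

definition covector :: "real ^ 'n \<Rightarrow> (real ^ 'n) \<Rightarrow>\<^sub>L real" where
  "covector a = blinfun_inner_right a"

definition covector_coords :: "(real ^ 'n) \<Rightarrow>\<^sub>L real \<Rightarrow> real ^ 'n" where
  "covector_coords \<alpha> = (\<chi> i. \<alpha> (axis i 1))"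

lemma covector_apply [simp]: "blinfun_apply (covector a) x = a \<bullet> x"
  by (simp add: covector_def)

lemma covector_coords_covector [simp]: "covector_coords (covector a) = a"
  by (simp add: covector_coords_def vec_eq_iff inner_axis)

lemma covector_covector_coords [simp]: "covector (covector_coords \<alpha>) = \<alpha>"
proof (rule blinfun_eqI)
  fix x :: "real ^ 'a"
  have "blinfun_apply \<alpha> x = blinfun_apply \<alpha> (\<Sum>i\<in>UNIV. (x $ i) *\<^sub>R axis i 1)"
    by (simp add: basis_expansion flip: scalar_mult_eq_scaleR)
  then show "blinfun_apply (covector (covector_coords \<alpha>)) x = blinfun_apply \<alpha> x"
    by (simp add: covector_coords_def inner_vec_def blinfun.sum_right blinfun.scaleR_right
        mult.commute)
qed

lemma linear_covector: "linear covector"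
  by (auto intro!: linearI blinfun_eqI simp: inner_add_left blinfun.add_left blinfun.scaleR_left)

lemma linear_covector_coords: "linear covector_coords"
  by (auto intro!: linearI simp: covector_coords_def vec_eq_iff blinfun.add_left blinfun.scaleR_left)

definition from_coords :: "(real ^ 'n) \<times> (real ^ 'n) \<Rightarrow> (real ^ 'n) \<times> ((real ^ 'n) \<Rightarrow>\<^sub>L real)" where
  "from_coords u = (fst u, covector (snd u))"

definition to_coords :: "(real ^ 'n) \<times> ((real ^ 'n) \<Rightarrow>\<^sub>L real) \<Rightarrow> (real ^ 'n) \<times> (real ^ 'n)" where
  "to_coords u = (fst u, covector_coords (snd u))"

lemma to_from_coords [simp]: "to_coords (from_coords u) = u"
  and from_to_coords [simp]: "from_coords (to_coords v) = v"
  by (simp_all add: from_coords_def to_coords_def)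

lemma linear_from_coords: "linear from_coords"
  by (rule linearI)
    (simp_all add: from_coords_def linear_add[OF linear_covector] linear_scale[OF linear_covector])

lemma linear_to_coords: "linear to_coords"
  by (rule linearI)
    (simp_all add: to_coords_def linear_add[OF linear_covector_coords]
      linear_scale[OF linear_covector_coords])

text \<open>The covector part lists the values of \<alpha> o ad y - \<beta> o ad x on the standard
  basis, for u = (x, \<alpha>) and v = (y, \<beta>).\<close>

definition courant_coords ::
  "(real ^ 'n \<Rightarrow> real ^ 'n \<Rightarrow> real ^ 'n) \<Rightarrow>
     (real ^ 'n) \<times> (real ^ 'n) \<Rightarrow> (real ^ 'n) \<times> (real ^ 'n) \<Rightarrow> (real ^ 'n) \<times> (real ^ 'n)" where
  "courant_coords br u v =
     (br (fst u) (fst v),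
      \<chi> m. snd u \<bullet> br (fst v) (axis m 1) - snd v \<bullet> br (fst u) (axis m 1))"

definition nijenhuis ::
  "(real ^ 'n \<Rightarrow> real ^ 'n \<Rightarrow> real ^ 'n) \<Rightarrow>
     ((real ^ 'n) \<times> (real ^ 'n) \<Rightarrow> (real ^ 'n) \<times> (real ^ 'n)) \<Rightarrow>
     (real ^ 'n) \<times> (real ^ 'n) \<Rightarrow> (real ^ 'n) \<times> (real ^ 'n) \<Rightarrow> (real ^ 'n) \<times> (real ^ 'n)" where
  "nijenhuis br K u v = courant_coords br u v + K (courant_coords br (K u) v)
     + K (courant_coords br u (K v)) - courant_coords br (K u) (K v)"

lemma courant_bracket_from_coords:
  assumes "lie_algebra br"
  shows "courant_bracket br (from_coords u) (from_coords v) = from_coords (courant_coords br u v)"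
proof -
  have "to_coords (courant_bracket br (from_coords u) (from_coords v)) = courant_coords br u v"
    by (simp add: courant_bracket_def from_coords_def to_coords_def courant_coords_def
        covector_coords_def vec_eq_iff blinfun.diff_left ad_apply[OF assms])
  then show ?thesis
    by (metis from_to_coords)
qed

lemma pairing_from_coords:
  "pairing (from_coords u) (from_coords v) = (snd v \<bullet> fst u + snd u \<bullet> fst v) / 2"
  by (simp add: pairing_def from_coords_def)

text \<open>The linear isomorphism \<open>from_coords\<close> respects pairing and Courant bracket,
  so conjugating \<open>K\<close> by it carries every axiom over.\<close>

lemma admits_gcs_from_coords:
  fixes K :: "(real ^ 'n) \<times> (real ^ 'n) \<Rightarrow> (real ^ 'n) \<times> (real ^ 'n)"
  assumes lie: "lie_algebra br" and lin: "linear K"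
    and sq: "\<And>u. K (K u) = - u"
    and orth: "\<And>u v. snd (K v) \<bullet> fst (K u) + snd (K u) \<bullet> fst (K v)
                 = snd v \<bullet> fst u + snd u \<bullet> fst v"
    and int: "\<And>u v. nijenhuis br K u v = 0"
    and card: "CARD('n) = 2 * n" "k \<le> n"
    and dim: "dim (range (\<lambda>a. fst (K (0, a)))) = 2 * (n - k)"
  shows "admits_gcs_of_type br k"
proof -
  define J where "J = from_coords \<circ> K \<circ> to_coords"
  have J: "J (from_coords u) = from_coords (K u)" for u
    by (simp add: J_def)
  have ex: "\<exists>w. u = from_coords w" for u :: "(real ^ 'n) \<times> ((real ^ 'n) \<Rightarrow>\<^sub>L real)"
    by (metis from_to_coords)
  have linJ: "linear J"
    unfolding J_def
    by (intro linear_compose lin linear_from_coords linear_to_coords)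
  have "J (J u) = - u" for u
    using ex[of u] by (metis J sq linear_neg[OF linear_from_coords])
  moreover have "pairing (J u) (J v) = pairing u v" for u v
    using ex[of u] ex[of v] by (auto simp: J pairing_from_coords orth)
  moreover have "courant_bracket br u v + J (courant_bracket br (J u) v)
      + J (courant_bracket br u (J v)) - courant_bracket br (J u) (J v) = 0" for u v
  proof -
    obtain u' v' where "u = from_coords u'" "v = from_coords v'"
      using ex by blast
    then show ?thesis
      using int[of u' v']
      by (simp add: J nijenhuis_def courant_bracket_from_coords[OF lie] linear_0[OF linear_from_coords]
          flip: linear_add[OF linear_from_coords] linear_diff[OF linear_from_coords])
  qed
  ultimately have "generalized_complex_structure br J"
    using lie linJ by (simp add: generalized_complex_structure_def)
  \<comment> \<open>The argument is only reparametrized by the surjection \<open>covector\<close>,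
    so the rank is unchanged.\<close>
  moreover have "range (J2_block J) = range (\<lambda>a. fst (K (0, a)))"
  proof -
    have "J2_block J (covector a) = fst (K (0, a))" for a
      by (simp add: J2_block_def J_def from_coords_def to_coords_def)
    moreover have "surj (covector :: real ^ 'n \<Rightarrow> _)"
      by (metis covector_covector_coords surjI)
    ultimately show ?thesis
      by (metis (no_types, lifting) fun.set_map image_cong image_image)
  qed
  then have "has_type J k"
    using card dim by (auto simp: has_type_def)
  ultimately show ?thesis
    by (auto simp: admits_gcs_of_type_def)
qed

section \<open>Block structures on two coordinate planes and their types\<close>

text \<open>\<open>complex_block i j s\<close> comes from the complex structure \<open>e\<^sub>i \<mapsto> s e\<^sub>j\<close> of the plane spanned by
  \<open>e\<^sub>i, e\<^sub>j\<close>, and \<open>symplectic_block i j s\<close> from the symplectic form \<open>s e\<^sup>i \<and> e\<^sup>j\<close> on it.\<close>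

definition complex_block ::
  "'n \<Rightarrow> 'n \<Rightarrow> real \<Rightarrow> (real ^ 'n) \<times> (real ^ 'n) \<Rightarrow> (real ^ 'n) \<times> (real ^ 'n)" where
  "complex_block i j s u =
     ((s * fst u $ i) *\<^sub>R axis j 1 - (fst u $ j / s) *\<^sub>R axis i 1,
      (snd u $ i / s) *\<^sub>R axis j 1 - (s * snd u $ j) *\<^sub>R axis i 1)"

definition symplectic_block ::
  "'n \<Rightarrow> 'n \<Rightarrow> real \<Rightarrow> (real ^ 'n) \<times> (real ^ 'n) \<Rightarrow> (real ^ 'n) \<times> (real ^ 'n)" where
  "symplectic_block i j s u =
     ((snd u $ i / s) *\<^sub>R axis j 1 - (snd u $ j / s) *\<^sub>R axis i 1,
      (s * fst u $ i) *\<^sub>R axis j 1 - (s * fst u $ j) *\<^sub>R axis i 1)"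

lemma linear_complex_block: "linear (complex_block i j s)"
  by (rule linearI) (simp_all add: complex_block_def algebra_simps add_divide_distrib)

lemma linear_symplectic_block: "linear (symplectic_block i j s)"
  by (rule linearI) (simp_all add: symplectic_block_def algebra_simps add_divide_distrib)

lemmas block_defs = complex_block_def symplectic_block_def

lemma UNIV_4_eq_if_distinct:
  fixes i j k l :: 4
  assumes "distinct [i, j, k, l]"
  shows "UNIV = {i, j, k, l}"
  using assms by (intro card_subset_eq[symmetric]) simp_all

lemma admits_gcs_blocks:
  fixes i j k l :: 4
  assumes lie: "lie_algebra br"
    and ijkl: "distinct [i, j, k, l]"
    and F: "F \<in> {complex_block i j s, symplectic_block i j s}"
    and G: "G \<in> {complex_block k l t, symplectic_block k l t}"
    and st: "s \<noteq> 0" "t \<noteq> 0"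
    and int: "\<And>u v. nijenhuis br (\<lambda>w. F w + G w) u v = 0"
    and n: "n \<le> 2"
    and dim: "dim (range (\<lambda>a. fst (F (0, a) + G (0, a)))) = 2 * (2 - n)"
  shows "admits_gcs_of_type br n"
proof (rule admits_gcs_from_coords[where K = "\<lambda>w. F w + G w" and n = 2])
  have idx: "(\<forall>m. P m) \<longleftrightarrow> P i \<and> P j \<and> P k \<and> P l" for P
    using UNIV_4_eq_if_distinct[OF ijkl] by (metis UNIV_I empty_iff insert_iff)
  have sum4: "(\<Sum>m\<in>UNIV. f m) = f i + f j + f k + f l" for f :: "4 \<Rightarrow> real"
    unfolding UNIV_4_eq_if_distinct[OF ijkl] using ijkl by (simp add: add.assoc)
  have ne: "i \<noteq> j" "i \<noteq> k" "i \<noteq> l" "j \<noteq> k" "j \<noteq> l" "k \<noteq> l"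
      "j \<noteq> i" "k \<noteq> i" "l \<noteq> i" "k \<noteq> j" "l \<noteq> j" "l \<noteq> k"
    using ijkl by auto
  show "linear (\<lambda>w. F w + G w)"
    using F G by (auto intro!: linear_compose_add linear_complex_block linear_symplectic_block)
  show "F (F u + G u) + G (F u + G u) = - u" for u
    using F G st
    by (elim insertE emptyE)
      (simp_all add: block_defs prod_eq_iff vec_eq_iff idx axis_def ne)
  show "snd (F v + G v) \<bullet> fst (F u + G u) + snd (F u + G u) \<bullet> fst (F v + G v)
      = snd v \<bullet> fst u + snd u \<bullet> fst v" for u v
    using F G st
    by (elim insertE emptyE)
      (simp_all add: block_defs inner_vec_def sum4 axis_def ne field_simps)
qed (use lie int n dim in simp_all)

text \<open>A complex block keeps vectors and covectors apart, so J_2 comes from the symplectic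
  block alone.\<close>

lemma dim_range_symplectic_complex:
  fixes i j k l :: "'n::finite"
  assumes "i \<noteq> j" "s \<noteq> 0"
  shows "dim (range (\<lambda>a. fst (symplectic_block i j s (0, a) + complex_block k l t (0, a)))) = 2"
proof -
  let ?B = "{axis i 1, axis j 1 :: real ^ 'n}"
  have base: "axis i 1 \<in> span ?B" "axis j 1 \<in> span ?B"
    by (simp_all add: span_base)
  have "range (\<lambda>a. fst (symplectic_block i j s (0, a) + complex_block k l t (0, a))) = span ?B"
  proof (intro subset_antisym subsetI)
    fix x
    assume "x \<in> range (\<lambda>a. fst (symplectic_block i j s (0, a) + complex_block k l t (0, a)))"
    then show "x \<in> span ?B"
      by (auto simp: block_defs intro!: span_diff span_scale base)
  next
    fix x
    assume "x \<in> span ?B"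
    then obtain p q where "x = p *\<^sub>R axis i 1 + q *\<^sub>R axis j 1"
      by (auto simp: span_insert algebra_simps)
    \<comment> \<open>The block sends the covector e^i to e_j / s and e^j to - e_i / s; inverting
      this gives the witness.\<close>
    then have "x = fst (symplectic_block i j s (0, (s * q) *\<^sub>R axis i 1 - (s * p) *\<^sub>R axis j 1)
        + complex_block k l t (0, (s * q) *\<^sub>R axis i 1 - (s * p) *\<^sub>R axis j 1))"
      using assms by (simp add: block_defs vec_eq_iff axis_def)
    then show "x \<in> range (\<lambda>a. fst (symplectic_block i j s (0, a) + complex_block k l t (0, a)))"
      by blast
  qed
  moreover have "card ?B = 2"
    using assms by (simp add: axis_eq_axis)
  moreover have "independent ?B"
    by (rule independent_mono[OF independent_Basis]) (auto simp: axis_in_Basis_iff)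
  ultimately show ?thesis
    by (simp add: dim_eq_card_independent)
qed

lemma admits_type_0:
  fixes i j k l :: 4
  assumes lie: "lie_algebra br"
    and ijkl: "distinct [i, j, k, l]"
    and st: "s \<noteq> 0" "t \<noteq> 0"
    and int: "\<And>u v. nijenhuis br (\<lambda>w. symplectic_block i j s w + symplectic_block k l t w) u v = 0"
  shows "admits_gcs_of_type br 0"
proof (rule admits_gcs_blocks[OF lie ijkl _ _ st int])
  let ?f = "\<lambda>a. fst (symplectic_block i j s (0, a) + symplectic_block k l t (0, a))"
  have idx: "(\<forall>m. P m) \<longleftrightarrow> P i \<and> P j \<and> P k \<and> P l" for P
    using UNIV_4_eq_if_distinct[OF ijkl] by (metis UNIV_I empty_iff insert_iff)
  \<comment> \<open>A right inverse of J_2, found by inverting each symplectic block; the last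
    branch is the index \<open>l\<close>.\<close>
  have "?f (\<chi> m. if m = i then s * x $ j else if m = j then - s * x $ i
      else if m = k then t * x $ l else - t * x $ k) = x" for x
    using ijkl st by (auto simp: block_defs vec_eq_iff idx axis_def)
  then have "surj ?f"
    by (rule surjI)
  then show "dim (range ?f) = 2 * (2 - 0)"
    by simp
qed simp_all

lemma admits_type_1:
  fixes i j k l :: 4
  assumes "lie_algebra br"
    and ijkl: "distinct [i, j, k, l]"
    and st: "s \<noteq> 0" "t \<noteq> 0"
    and "\<And>u v. nijenhuis br (\<lambda>w. symplectic_block i j s w + complex_block k l t w) u v = 0"
  shows "admits_gcs_of_type br 1"
proof (rule admits_gcs_blocks[OF assms(1,2) _ _ assms(3-5)])
  show "dim (range (\<lambda>a. fst (symplectic_block i j s (0, a) + complex_block k l t (0, a)))) = 2 * (2 - 1)"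
    using dim_range_symplectic_complex[of i j s k l t] ijkl st by simp
qed simp_all

lemma admits_type_2:
  fixes i j k l :: 4
  assumes "lie_algebra br"
    and ijkl: "distinct [i, j, k, l]"
    and st: "s \<noteq> 0" "t \<noteq> 0"
    and "\<And>u v. nijenhuis br (\<lambda>w. complex_block i j s w + complex_block k l t w) u v = 0"
  shows "admits_gcs_of_type br 2"
proof (rule admits_gcs_blocks[OF assms(1,2) _ _ assms(3-5)])
  show "dim (range (\<lambda>a. fst (complex_block i j s (0, a) + complex_block k l t (0, a)))) = 2 * (2 - 2)"
    by (simp add: complex_block_def)
qed simp_all

section \<open>Componentwise form of the integrability condition\<close>

lemma plane_block_nth:
  "fst (complex_block i j s u) $ m
     = (if m = j then s * fst u $ i else 0) - (if m = i then fst u $ j / s else 0)"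
  "snd (complex_block i j s u) $ m
     = (if m = j then snd u $ i / s else 0) - (if m = i then s * snd u $ j else 0)"
  "fst (symplectic_block i j s u) $ m
     = (if m = j then snd u $ i / s else 0) - (if m = i then snd u $ j / s else 0)"
  "snd (symplectic_block i j s u) $ m
     = (if m = j then s * fst u $ i else 0) - (if m = i then s * fst u $ j else 0)"
  by (simp_all add: block_defs axis_def)

lemma axis_nth_if: "axis i (1::real) $ m = (if m = i then 1 else 0)"
  by (simp add: axis_def)

lemma e_nth: "e i $ m = (if m = i then 1 else 0)"
  by (simp add: e_def axis_nth_if)

lemma inner_e: "a \<bullet> e i = a $ i"
  by (simp add: e_def inner_axis)

text \<open>For numeral plane indices the simplifier decides all index tests, which leaves
  identities between real components of \<open>u\<close> and \<open>v\<close>.\<close>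

lemmas nijenhuis_simps = four_dim_defs nijenhuis_def courant_coords_def bracket_of_def
  plane_block_nth axis_nth_if e_nth inner_e inner_add_right inner_diff_right
  prod_eq_iff vec_eq_iff all_index field_simps

section \<open>The individual algebras: choice of planes and signs\<close>

text \<open>The planes are the factors of a product. In dimension two every almost complex structure
  is integrable and every 2-form closed, so all combinations work.\<close>

lemma admits_gcs_aff_R_aff_R:
  shows "admits_gcs_of_type aff_R_aff_R 0"
    and "admits_gcs_of_type aff_R_aff_R 1"
    and "admits_gcs_of_type aff_R_aff_R 2"
  by ((rule admits_type_0[OF lie_algebras_four_dim(1), of 0 1 2 3 1 1];
        simp add: nijenhuis_simps),
      (rule admits_type_1[OF lie_algebras_four_dim(1), of 0 1 2 3 1 1];
        simp add: nijenhuis_simps),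
      (rule admits_type_2[OF lie_algebras_four_dim(1), of 0 1 2 3 1 1];
        simp add: nijenhuis_simps))

text \<open>The span of e_0, e_1 acts complex linearly on the ideal spanned by e_2, e_3, whence
  types 1 and 2. Type 0 uses the exact form -d e^3, as ad e_0 does not preserve area on that
  ideal.\<close>

lemma admits_gcs_aff_C:
  shows "admits_gcs_of_type aff_C 0"
    and "admits_gcs_of_type aff_C 1"
    and "admits_gcs_of_type aff_C 2"
  by ((rule admits_type_0[OF lie_algebras_four_dim(2), of 0 3 1 2 1 1];
        simp add: nijenhuis_simps),
      (rule admits_type_1[OF lie_algebras_four_dim(2), of 0 1 2 3 1 1];
        simp add: nijenhuis_simps),
      (rule admits_type_2[OF lie_algebras_four_dim(2), of 0 1 2 3 1 1];
        simp add: nijenhuis_simps))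

text \<open>ad e_1 rotates the plane of e_2, e_3, so it commutes with the complex structure and
  preserves the area form.\<close>

lemma admits_gcs_R_e2:
  shows "admits_gcs_of_type R_e2 0"
    and "admits_gcs_of_type R_e2 1"
    and "admits_gcs_of_type R_e2 2"
  by ((rule admits_type_0[OF lie_algebras_four_dim(3), of 0 1 2 3 1 1];
        simp add: nijenhuis_simps),
      (rule admits_type_1[OF lie_algebras_four_dim(3), of 0 1 2 3 1 1];
        simp add: nijenhuis_simps),
      (rule admits_type_2[OF lie_algebras_four_dim(3), of 0 1 2 3 1 1];
        simp add: nijenhuis_simps))

lemma admits_gcs_R_h3:
  shows "admits_gcs_of_type R_h3 0"
    and "admits_gcs_of_type R_h3 1"
    and "admits_gcs_of_type R_h3 2"
  by ((rule admits_type_0[OF lie_algebras_four_dim(4), of 0 1 2 3 1 1];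
        simp add: nijenhuis_simps),
      \<comment> \<open>The symplectic plane comes first: e^2 \<and> e^3 and e^0 + i e^1 are both
        closed.\<close>
      (rule admits_type_1[OF lie_algebras_four_dim(4), of 2 3 0 1 1 1];
        simp add: nijenhuis_simps),
      (rule admits_type_2[OF lie_algebras_four_dim(4), of 0 3 1 2 1 1];
        simp add: nijenhuis_simps))

text \<open>Again a product: e_1, e_2 span a copy of aff(R), and e_0, e_3 are central.\<close>

lemma admits_gcs_R_r30:
  shows "admits_gcs_of_type R_r30 0"
    and "admits_gcs_of_type R_r30 1"
    and "admits_gcs_of_type R_r30 2"
  by ((rule admits_type_0[OF lie_algebras_four_dim(5), of 0 3 1 2 1 1];
        simp add: nijenhuis_simps),
      (rule admits_type_1[OF lie_algebras_four_dim(5), of 0 3 1 2 1 1];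
        simp add: nijenhuis_simps),
      (rule admits_type_2[OF lie_algebras_four_dim(5), of 0 3 1 2 1 1];
        simp add: nijenhuis_simps))

text \<open>For type 0, e^1 \<and> e^3 is closed because the weights of ad e_0 are opposite; the
  complex plane e_2, e_3 has equal weights.\<close>

lemma admits_gcs_r4_m1_m1:
  shows "admits_gcs_of_type r4_m1_m1 0"
    and "admits_gcs_of_type r4_m1_m1 1"
    and "admits_gcs_of_type r4_m1_m1 2"
  by ((rule admits_type_0[OF lie_algebras_four_dim(6), of 0 2 1 3 1 1];
        simp add: nijenhuis_simps),
      (rule admits_type_1[OF lie_algebras_four_dim(6), of 0 1 2 3 1 1];
        simp add: nijenhuis_simps),
      (rule admits_type_2[OF lie_algebras_four_dim(6), of 0 1 2 3 1 1];
        simp add: nijenhuis_simps))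

lemma admits_gcs_r4'_0:
  shows "admits_gcs_of_type (r4'_0 \<mu>) 0"
    and "admits_gcs_of_type (r4'_0 \<mu>) 1"
    and "admits_gcs_of_type (r4'_0 \<mu>) 2"
  by ((rule admits_type_0[OF lie_algebras_four_dim(7)[of \<mu>], of 0 1 2 3 1 1];
        simp add: nijenhuis_simps),
      (rule admits_type_1[OF lie_algebras_four_dim(7)[of \<mu>], of 0 1 2 3 1 1];
        simp add: nijenhuis_simps),
      (rule admits_type_2[OF lie_algebras_four_dim(7)[of \<mu>], of 0 1 2 3 1 1];
        simp add: nijenhuis_simps))

text \<open>ad e_0 is scalar on the plane of e_1, e_2. In type 1 the form e^0 \<and> e^3 is not
  closed, but its differential vanishes after wedging with e^1 + i e^2. Type 0 uses -d e^3.\<close>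

lemma admits_gcs_d4_half:
  shows "admits_gcs_of_type (d4 (1/2)) 0"
    and "admits_gcs_of_type (d4 (1/2)) 1"
    and "admits_gcs_of_type (d4 (1/2)) 2"
  by ((rule admits_type_0[OF lie_algebras_four_dim(8)[of "1/2"], of 0 3 1 2 1 1];
        simp add: nijenhuis_simps),
      (rule admits_type_1[OF lie_algebras_four_dim(8)[of "1/2"], of 0 3 1 2 1 1];
        simp add: nijenhuis_simps),
      (rule admits_type_2[OF lie_algebras_four_dim(8)[of "1/2"], of 0 3 1 2 1 1];
        simp add: nijenhuis_simps))

lemma admits_gcs_d4_2:
  shows "admits_gcs_of_type (d4 2) 0"
    and "admits_gcs_of_type (d4 2) 1"
    and "admits_gcs_of_type (d4 2) 2"
  by ((rule admits_type_0[OF lie_algebras_four_dim(8)[of 2], of 0 1 2 3 1 1];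
        simp add: nijenhuis_simps),
      (rule admits_type_1[OF lie_algebras_four_dim(8)[of 2], of 2 3 0 1 1 1];
        simp add: nijenhuis_simps),
      \<comment> \<open>For e_0 -> e_2 and e_1 -> t e_3 the Nijenhuis tensor at (e_0, e_1) is (1 +
        1/t) e_1, which forces t = -1.\<close>
      (rule admits_type_2[OF lie_algebras_four_dim(8)[of 2], of 0 2 1 3 1 "-1"];
        simp add: nijenhuis_simps))

text \<open>For I e_1 = e_2, ad e_0 is \<open>lam\<close> - I on the plane of e_1, e_2 and so
  commutes with I. In type 0 a nonzero \<open>lam\<close> makes the exact form
  nondegenerate.\<close>

lemma admits_gcs_d4':
  assumes "lam \<noteq> 0"
  shows "admits_gcs_of_type (d4' lam) 0"
    and "admits_gcs_of_type (d4' lam) 1"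
    and "admits_gcs_of_type (d4' lam) 2"
  by ((rule admits_type_0[OF lie_algebras_four_dim(9)[of lam], of 0 3 1 2 "2 * lam" 1];
        simp add: nijenhuis_simps assms),
      (rule admits_type_1[OF lie_algebras_four_dim(9)[of lam], of 0 3 1 2 1 1];
        simp add: nijenhuis_simps assms),
      (rule admits_type_2[OF lie_algebras_four_dim(9)[of lam], of 0 3 1 2 1 1];
        simp add: nijenhuis_simps assms))

theorem proposition5p1:
  shows "\<forall>k \<in> {0, 1, 2}.
     admits_gcs_of_type aff_R_aff_R k \<and>
     admits_gcs_of_type aff_C k \<and>
     admits_gcs_of_type R_e2 k \<and>
     admits_gcs_of_type R_h3 k \<and>
     admits_gcs_of_type R_r30 k \<and>
     admits_gcs_of_type r4_m1_m1 k \<and>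
     (\<forall>\<mu>>0. admits_gcs_of_type (r4'_0 \<mu>) k) \<and>
     admits_gcs_of_type (d4 (1/2)) k \<and>
     admits_gcs_of_type (d4 2) k \<and>
     (\<forall>lam>0. admits_gcs_of_type (d4' lam) k)"
  by (auto simp: admits_gcs_aff_R_aff_R admits_gcs_aff_C admits_gcs_R_e2 admits_gcs_R_h3
      admits_gcs_R_r30 admits_gcs_r4_m1_m1 admits_gcs_r4'_0 admits_gcs_d4_half admits_gcs_d4_2
      admits_gcs_d4' simp del: One_nat_def)

end
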